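(* Let $\mathbb{Y}$ be a set and let $\mathcal{F}(\mathbb{Y})\subset\mathbb{R}^{\mathbb{Y}}$ be a collection of functions, equipped with a metric $\widetilde d$ and the associated Borel $\sigma$-algebra $\mathcal{B}(\mathcal{F}(\mathbb{Y}))$. Assume that there exist a sequence $(y_n)_{n\ge1}$ in $\mathbb{Y}$ and a Borel measurable map $\rho\colon\mathbb{R}^{\mathbb{N}}\times\mathbb{R}^{\mathbb{N}}\to[0,\infty]$ such that, with $\Phi(f)=(f(y_n))_{n\ge1}$ for $f\in\mathcal{F}(\mathbb{Y})$, one has $\widetilde d(f,g)=\rho(\Phi(f),\Phi(g))$ for all $f,g\in\mathcal{F}(\mathbb{Y})$. Let $(\mathbb{X},\mathcal{A})$ be a measurable space, and let $G\colon\mathbb{X}\times\mathbb{Y}\to\mathbb{R}$ be such that (i) for every $y\in\mathbb{Y}$, the map $x\mapsto G(x,y)$ is $\mathcal{A}$-measurable, and (ii) for every $x\in\mathbb{X}$, $G(x,\cdot)\in\mathcal{F}(\mathbb{Y})$. Define $\widetilde G\colon\mathbb{X}\to\mathcal{F}(\mathbb{Y})$ by $\widetilde G(x)=G(x,\cdot)$. Let $\mu$ be a measure on $(\mathbb{X},\mathcal{A})$. If $\widetilde G$ has an essentially separable range, then it agrees $\mu$-almost everywhere with a measurable, strongly measurable map $\mathbb{X}\to\mathcal{F}(\mathbb{Y})$. In particular, $\widetilde G$ is strongly measurable in the usual almost-everywhere sense. If $(\mathbb{X},\mathcal{A},\mu)$ is complete, then $\widetilde G$ itself is also Borel measurable (that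 is, $\mathcal{A}/\mathcal{B}(\mathcal{F}(\mathbb{Y}))$-measurable).
   Context: A function from $(\mathbb{X},\mathcal{A},\mu)$ to a metric space is simple if it is measurable (for the Borel $\sigma$-algebra of the target) and takes only finitely many values; it is strongly measurable if it is the $\mu$-almost everywhere pointwise limit of a sequence of simple functions. A map $H$ on $\mathbb{X}$ has essentially separable range if there exists $N\in\mathcal{A}$ with $\mu(N)=0$ such that $H(\mathbb{X}\setminus N)$ is contained in a separable subset of the target metric space. *)

theory Defs
  imports "HOL-Analysis.Analysis"
begin

text \<open>A metric space is given by its carrier \<open>F\<close> and its metric \<open>d\<close>, as in the locale
  \<^locale>\<open>Metric_space\<close>. That locale also asks \<open>d\<close> to be nonnegative and symmetric off the carrier;
  the values there are irrelevant, and every metric on \<open>F\<close> extends in this way (for example by \<open>0\<close>).\<close>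

definition metric_borel :: "'a set \<Rightarrow> ('a \<Rightarrow> 'a \<Rightarrow> real) \<Rightarrow> 'a measure" where
  "metric_borel F d = sigma F {U. openin (Metric_space.mtopology F d) U}"

text \<open>Measurability here is for the Borel sets of the target; the library's
  \<^const>\<open>simple_function\<close> only asks for measurable fibres.\<close>

definition metric_simple ::
  "'x measure \<Rightarrow> 'a set \<Rightarrow> ('a \<Rightarrow> 'a \<Rightarrow> real) \<Rightarrow> ('x \<Rightarrow> 'a) \<Rightarrow> bool" where
  "metric_simple M F d s \<longleftrightarrow> s \<in> M \<rightarrow>\<^sub>M metric_borel F d \<and> finite (s ` space M)"

definition strongly_measurable ::
  "'x measure \<Rightarrow> 'a set \<Rightarrow> ('a \<Rightarrow> 'a \<Rightarrow> real) \<Rightarrow> ('x \<Rightarrow> 'a) \<Rightarrow> bool" where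
  "strongly_measurable M F d H \<longleftrightarrow> H \<in> space M \<rightarrow> F \<and>
     (\<exists>s :: nat \<Rightarrow> 'x \<Rightarrow> 'a. (\<forall>n. metric_simple M F d (s n)) \<and>
        (AE x in M. limitin (Metric_space.mtopology F d) (\<lambda>n. s n x) (H x) sequentially))"

definition essentially_separable_range ::
  "'x measure \<Rightarrow> 'a set \<Rightarrow> ('a \<Rightarrow> 'a \<Rightarrow> real) \<Rightarrow> ('x \<Rightarrow> 'a) \<Rightarrow> bool" where
  "essentially_separable_range M F d H \<longleftrightarrow>
     (\<exists>N \<in> sets M. emeasure M N = 0 \<and>
        (\<exists>S \<subseteq> F. separable_space (subtopology (Metric_space.mtopology F d) S) \<and>
           H ` (space M - N) \<subseteq> S))"

text \<open>The map \<open>x \<mapsto> G(x, \<cdot>)\<close>.\<close>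

definition fibre_map :: "('x \<times> 'y \<Rightarrow> real) \<Rightarrow> 'x \<Rightarrow> ('y \<Rightarrow> real)" where
  "fibre_map G = (\<lambda>x y. G (x, y))"

end

theory Submission
  imports Defs
begin

text \<open>A Borel measurable map into a nonseparable metric space need not be controlled by its
  distances to points, because an open set need not be a countable union of balls. The two
  ingredients below repair this.

  First, every distance \<open>x \<mapsto> d f (G(x, \<cdot>))\<close> with \<open>f \<in> F\<close> is measurable: it is \<open>\<rho>\<close> composed with
  \<open>x \<mapsto> (\<Phi> f, \<Phi> (G(x, \<cdot>)))\<close>, whose coordinates are constants or the measurable functions
  \<open>G(\<cdot>, y\<^sub>n)\<close>. Secondly, if a map \<open>H\<close> takes values in the closure of a sequence \<open>c\<close> and all the
  functions \<open>x \<mapsto> d (c n) (H x)\<close> are measurable, then \<open>H\<close> is Borel measurable, since the preimage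
  of an open set is a countable union of sets \<open>{x. d (c n) (H x) < r}\<close>
  (\<open>measurable_metric_borelI\<close>), and \<open>H\<close> is an everywhere limit of simple maps: the \<open>n\<close>-th one sends
  \<open>x\<close> to a point nearest to \<open>H x\<close> among \<open>c 0, \<dots>, c n\<close> (\<open>strongly_measurableI\<close>).

  On the exceptional null set \<open>N\<close> the fibre map is replaced by a constant \<open>f0 \<in> F\<close>. The modified map
  has its whole range in the closure of a sequence that enumerates \<open>f0\<close> and a countable dense subset
  of the separable set, so both lemmas apply to it. Strong measurability depends only on the map up
  to null sets, and over a complete measure so does measurability.\<close>

section \<open>Maps into the closure of a sequence\<close>

lemma space_metric_borel [simp]:
  assumes "Metric_space F d"
  shows "space (metric_borel F d) = F"
  using openin_subset[of "Metric_space.mtopology F d"]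
  by (auto simp: metric_borel_def space_measure_of_conv)

lemma open_sets_metric_borel:
  assumes "Metric_space F d"
  shows "{U. openin (Metric_space.mtopology F d) U} \<subseteq> Pow F"
  using openin_subset[of "Metric_space.mtopology F d"] Metric_space.topspace_mtopology[OF assms]
  by auto

lemma measurable_metric_borelI:
  fixes c :: "nat \<Rightarrow> 'a"
  assumes metric: "Metric_space F d"
    and c: "\<And>n. c n \<in> F"
    and H: "H \<in> space M \<rightarrow> F"
    and dense: "\<And>x e. x \<in> space M \<Longrightarrow> e > 0 \<Longrightarrow> \<exists>n. d (c n) (H x) < e"
    and dist [measurable]: "\<And>n. (\<lambda>x. d (c n) (H x)) \<in> borel_measurable M"
  shows "H \<in> M \<rightarrow>\<^sub>M metric_borel F d"
  unfolding metric_borel_def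
proof (rule measurable_measure_of[OF open_sets_metric_borel[OF metric] H], safe)
  interpret Metric_space F d by (rule metric)
  fix U assume U: "openin mtopology U"
  define I where "I = {(n, q). q \<in> \<rat> \<and> mball (c n) q \<subseteq> U}"
  have "I \<subseteq> UNIV \<times> \<rat>"
    by (auto simp: I_def)
  then have I: "countable I"
    by (rule countable_subset) (simp add: countable_rat)
  have "H -` U \<inter> space M = (\<Union>(n, q)\<in>I. {x \<in> space M. d (c n) (H x) < q})"
  proof (intro equalityI subsetI)
    fix x assume x: "x \<in> H -` U \<inter> space M"
    then have Hx: "H x \<in> F"
      using H by auto
    obtain r where r: "r > 0" "mball (H x) r \<subseteq> U"
      using U x unfolding openin_mtopology by blast
    obtain q where q: "q \<in> \<rat>" "0 < q" "q < r / 2"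
      using Rats_dense_in_real[of 0 "r / 2"] r by auto
    obtain n where n: "d (c n) (H x) < q"
      using dense[of x q] x q by auto
    \<comment> \<open>\<open>H x\<close> lies in a ball of radius \<open>q\<close> about \<open>c n\<close>, and \<open>2 q < r\<close>.\<close>
    have "mball (c n) q \<subseteq> mball (H x) r"
    proof
      fix z assume z: "z \<in> mball (c n) q"
      then have "d (H x) z \<le> d (H x) (c n) + d (c n) z"
        using Hx c by (intro triangle) auto
      then show "z \<in> mball (H x) r"
        using z n q Hx commute[of "H x" "c n"] by auto
    qed
    then have "(n, q) \<in> I"
      using r q by (auto simp: I_def)
    then show "x \<in> (\<Union>(n, q)\<in>I. {x \<in> space M. d (c n) (H x) < q})"
      using n x by blast
  next
    fix x assume "x \<in> (\<Union>(n, q)\<in>I. {x \<in> space M. d (c n) (H x) < q})"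
    then obtain n q where "mball (c n) q \<subseteq> U" "x \<in> space M" "d (c n) (H x) < q"
      by (auto simp: I_def)
    moreover have "H x \<in> F"
      using H \<open>x \<in> space M\<close> by auto
    ultimately show "x \<in> H -` U \<inter> space M"
      using c by auto
  qed
  also have "\<dots> \<in> sets M"
    using I by (intro sets.countable_UN') auto
  finally show "H -` U \<inter> space M \<in> sets M" .
qed

lemma strongly_measurableI:
  fixes c :: "nat \<Rightarrow> 'a"
  assumes metric: "Metric_space F d"
    and c: "\<And>n. c n \<in> F"
    and H: "H \<in> space M \<rightarrow> F"
    and dense: "\<And>x e. x \<in> space M \<Longrightarrow> e > 0 \<Longrightarrow> \<exists>n. d (c n) (H x) < e"
    and dist [measurable]: "\<And>n. (\<lambda>x. d (c n) (H x)) \<in> borel_measurable M"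
  shows "strongly_measurable M F d H"
proof -
  interpret Metric_space F d by (rule metric)
  define k where "k n x = (LEAST i. i \<le> n \<and> (\<forall>j\<in>{..n}. d (c i) (H x) \<le> d (c j) (H x)))" for n x
  have k: "k n x \<le> n \<and> (\<forall>j\<in>{..n}. d (c (k n x)) (H x) \<le> d (c j) (H x))" for n x
  proof -
    obtain i where "i \<in> {..n}" "\<forall>j\<in>{..n}. d (c i) (H x) \<le> d (c j) (H x)"
      using ex_is_arg_min_if_finite[of "{..n}" "\<lambda>j. d (c j) (H x)"]
      by (auto simp: is_arg_min_linorder)
    then have "\<exists>i. i \<le> n \<and> (\<forall>j\<in>{..n}. d (c i) (H x) \<le> d (c j) (H x))"
      by auto
    then show ?thesis
      unfolding k_def by (rule LeastI_ex)
  qed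
  have k_measurable: "k n \<in> M \<rightarrow>\<^sub>M count_space UNIV" for n
    unfolding k_def[abs_def] by measurable
  have "metric_simple M F d (\<lambda>x. c (k n x))" for n
    unfolding metric_simple_def
  proof
    have "c \<in> count_space UNIV \<rightarrow>\<^sub>M metric_borel F d"
      using c metric by simp
    from measurable_compose[OF k_measurable this]
    show "(\<lambda>x. c (k n x)) \<in> M \<rightarrow>\<^sub>M metric_borel F d" .
    have "(\<lambda>x. c (k n x)) ` space M \<subseteq> c ` {..n}"
      using k by auto
    then show "finite ((\<lambda>x. c (k n x)) ` space M)"
      by (rule finite_subset) simp
  qed
  moreover have "limitin mtopology (\<lambda>n. c (k n x)) (H x) sequentially" if x: "x \<in> space M" for x
    unfolding limitin_metric
  proof (intro conjI allI impI)
    show Hx: "H x \<in> F"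
      using H x by auto
    fix e :: real assume "e > 0"
    then obtain m where m: "d (c m) (H x) < e"
      using dense[OF x] by auto
    have "d (c (k n x)) (H x) < e" if "n \<ge> m" for n
      using k[of n x] that m by (meson atMost_iff le_less_trans)
    then show "\<forall>\<^sub>F n in sequentially. c (k n x) \<in> F \<and> d (c (k n x)) (H x) < e"
      using c by (auto simp: eventually_sequentially)
  qed
  ultimately show ?thesis
    unfolding strongly_measurable_def using H
    by (intro conjI exI[of _ "\<lambda>n x. c (k n x)"]) auto
qed

section \<open>Modification on null sets\<close>

lemma strongly_measurable_cong_AE:
  assumes "strongly_measurable M F d H" "AE x in M. G x = H x" "G \<in> space M \<rightarrow> F"
  shows "strongly_measurable M F d G"
proof -
  obtain s where s: "\<forall>n. metric_simple M F d (s n)"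
      "AE x in M. limitin (Metric_space.mtopology F d) (\<lambda>n. s n x) (H x) sequentially"
    using assms(1) unfolding strongly_measurable_def by auto
  from s(2) assms(2)
  have "AE x in M. limitin (Metric_space.mtopology F d) (\<lambda>n. s n x) (G x) sequentially"
    by eventually_elim simp
  with s(1) assms(3) show ?thesis
    unfolding strongly_measurable_def by blast
qed

lemma (in complete_measure) measurable_cong_off_null_set:
  assumes H: "H \<in> M \<rightarrow>\<^sub>M K" and N: "N \<in> null_sets M"
    and eq: "\<And>x. x \<in> space M - N \<Longrightarrow> G x = H x" and G: "G \<in> space M \<rightarrow> space K"
  shows "G \<in> M \<rightarrow>\<^sub>M K"
proof (rule measurableI)
  fix A assume "A \<in> sets K"
  then have "(H -` A \<inter> space M) - N \<in> sets M"
    using H N by (intro sets.Diff measurable_sets) auto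
  moreover have "G -` A \<inter> (N \<inter> space M) \<in> sets M"
    using N by (intro complete[of _ N]) auto
  moreover have "G -` A \<inter> space M = ((H -` A \<inter> space M) - N) \<union> (G -` A \<inter> (N \<inter> space M))"
    using eq by auto
  ultimately show "G -` A \<inter> space M \<in> sets M"
    by simp
qed (use G in auto)

section \<open>Measurability of distances to the fibre map\<close>

text \<open>The index set \<open>nat\<close> is countable and \<open>real\<close> is second countable, so the Borel sets of the
  sequence space are those of the product \<open>\<sigma>\<close>-algebra; this is why measurability of \<open>G(\<cdot>, y)\<close> for
  each fixed \<open>y\<close> suffices.\<close>

lemma borel_measurable_dist_fibre_map:
  fixes F :: "('y \<Rightarrow> real) set" and \<rho> :: "(nat \<Rightarrow> real) \<times> (nat \<Rightarrow> real) \<Rightarrow> ennreal"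
  assumes metric: "Metric_space F d"
    and rho: "\<rho> \<in> borel_measurable borel"
    and dist_eq: "\<And>f g. f \<in> F \<Longrightarrow> g \<in> F \<Longrightarrow> ennreal (d f g) = \<rho> (\<lambda>n. f (ys n), \<lambda>n. g (ys n))"
    and G_measurable: "\<And>y. (\<lambda>x. G (x, y)) \<in> borel_measurable M"
    and G: "fibre_map G \<in> space M \<rightarrow> F"
    and f: "f \<in> F"
  shows "(\<lambda>x. d f (fibre_map G x)) \<in> borel_measurable M"
proof -
  have "(\<lambda>x n. G (x, ys n)) \<in> borel_measurable M"
    by (rule measurable_coordinatewise_then_product) (rule G_measurable)
  then have "(\<lambda>x. (\<lambda>n. f (ys n), \<lambda>n. G (x, ys n))) \<in> borel_measurable M"
    by (intro borel_measurable_Pair) simp_all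
  from measurable_compose[OF this rho]
  have "(\<lambda>x. enn2real (\<rho> (\<lambda>n. f (ys n), \<lambda>n. G (x, ys n)))) \<in> borel_measurable M"
    by measurable
  moreover have "d f (fibre_map G x) = enn2real (\<rho> (\<lambda>n. f (ys n), \<lambda>n. G (x, ys n)))"
    if "x \<in> space M" for x
  proof -
    have "ennreal (d f (fibre_map G x)) = \<rho> (\<lambda>n. f (ys n), \<lambda>n. G (x, ys n))"
      using dist_eq[OF f, of "fibre_map G x"] G that by (auto simp: fibre_map_def)
    then show ?thesis
      using Metric_space.nonneg[OF metric] by (metis enn2real_ennreal)
  qed
  ultimately show ?thesis
    by (simp cong: measurable_cong)
qed

section \<open>Measurability of the fibre map\<close>

theorem corollary3p10:
  fixes F :: "('y \<Rightarrow> real) set"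
    and d :: "('y \<Rightarrow> real) \<Rightarrow> ('y \<Rightarrow> real) \<Rightarrow> real"
    and ys :: "nat \<Rightarrow> 'y"
    and \<rho> :: "(nat \<Rightarrow> real) \<times> (nat \<Rightarrow> real) \<Rightarrow> ennreal"
    and \<Phi> :: "('y \<Rightarrow> real) \<Rightarrow> nat \<Rightarrow> real"
    and M :: "'x measure"
    and G :: "'x \<times> 'y \<Rightarrow> real"
  assumes metric: "Metric_space F d"
    and rho_measurable: "\<rho> \<in> borel_measurable borel"
    and Phi_def: "\<And>f n. \<Phi> f n = f (ys n)"
    and dist_eq: "\<And>f g. f \<in> F \<Longrightarrow> g \<in> F \<Longrightarrow> ennreal (d f g) = \<rho> (\<Phi> f, \<Phi> g)"
    and G_measurable: "\<And>y. (\<lambda>x. G (x, y)) \<in> borel_measurable M"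
    and G_sections: "\<And>x. x \<in> space M \<Longrightarrow> (\<lambda>y. G (x, y)) \<in> F"
    and ess_separable: "essentially_separable_range M F d (fibre_map G)"
  shows "(\<exists>H. H \<in> M \<rightarrow>\<^sub>M metric_borel F d \<and> strongly_measurable M F d H \<and>
              (AE x in M. fibre_map G x = H x))
       \<and> strongly_measurable M F d (fibre_map G)
       \<and> (complete_measure M \<longrightarrow> fibre_map G \<in> M \<rightarrow>\<^sub>M metric_borel F d)"
proof -
  interpret Metric_space F d by (rule metric)
  have G: "fibre_map G \<in> space M \<rightarrow> F"
    using G_sections by (auto simp: fibre_map_def)
  have dist_G: "(\<lambda>x. d f (fibre_map G x)) \<in> borel_measurable M" if "f \<in> F" for f
  proof (rule borel_measurable_dist_fibre_map[OF metric rho_measurable _ G_measurable G that])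
    fix f g assume "f \<in> F" "g \<in> F"
    moreover have "\<Phi> h = (\<lambda>n. h (ys n))" for h
      by (rule ext) (rule Phi_def)
    ultimately show "ennreal (d f g) = \<rho> (\<lambda>n. f (ys n), \<lambda>n. g (ys n))"
      using dist_eq by metis
  qed
  obtain N S where N: "N \<in> null_sets M" and S: "S \<subseteq> F" "separable_space (subtopology mtopology S)"
    and GS: "fibre_map G ` (space M - N) \<subseteq> S"
    using ess_separable unfolding essentially_separable_range_def by (metis null_setsI)
  obtain C where C: "countable C" "C \<subseteq> S" "subtopology mtopology S closure_of C = S"
    using S unfolding separable_space_def by (auto simp: inf.absorb2)
  then have SC: "S \<subseteq> mtopology closure_of C"
    using closure_of_subtopology_subset by metis
  have "\<exists>H. H \<in> M \<rightarrow>\<^sub>M metric_borel F d \<and> strongly_measurable M F d H \<and>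
          (\<forall>x\<in>space M - N. fibre_map G x = H x)"
  proof (cases "F = {}")
    case True
    \<comment> \<open>Then \<open>space M\<close> is empty as well, and every condition is vacuous.\<close>
    then have "space M = {}"
      using G by auto
    then have "fibre_map G \<in> M \<rightarrow>\<^sub>M metric_borel F d"
      by (auto simp: measurable_def)
    moreover from this have "strongly_measurable M F d (fibre_map G)"
      unfolding strongly_measurable_def metric_simple_def using G \<open>space M = {}\<close>
      by (intro conjI exI[of _ "\<lambda>_. fibre_map G"]) auto
    ultimately show ?thesis
      by blast
  next
    case False
    then obtain f0 where f0: "f0 \<in> F"
      by auto
    define H where "H = (\<lambda>x. if x \<in> N then f0 else fibre_map G x)"
    define c where "c = from_nat_into (insert f0 C)"
    have range_c: "range c = insert f0 C"
      unfolding c_def using C(1) by (intro range_from_nat_into) auto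
    have c: "c n \<in> F" for n
      using rangeI[of c n] range_c f0 C(2) S(1) by auto
    have H: "H \<in> space M \<rightarrow> F"
      using G f0 by (auto simp: H_def)
    have dense: "\<exists>n. d (c n) (H x) < e" if x: "x \<in> space M" and e: "e > 0" for x e
    proof -
      have "\<exists>g\<in>insert f0 C. d g (H x) < e"
      proof (cases "x \<in> N")
        case True
        then show ?thesis
          using f0 e by (simp add: H_def)
      next
        case False
        then have "H x \<in> mtopology closure_of C"
          using x GS SC by (auto simp: H_def)
        then show ?thesis
          using e unfolding metric_closure_of by (auto simp: commute)
      qed
      then show ?thesis
        by (metis range_c rangeE)
    qed
    have dist: "(\<lambda>x. d (c n) (H x)) \<in> borel_measurable M" for n
    proof -
      have "(\<lambda>x. if x \<in> N then d (c n) f0 else d (c n) (fibre_map G x)) \<in> borel_measurable M"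
        using dist_G[OF c] N by (intro measurable_If_set) auto
      then show ?thesis
        by (simp add: H_def if_distrib)
    qed
    have "H \<in> M \<rightarrow>\<^sub>M metric_borel F d"
      by (rule measurable_metric_borelI[where c = c, OF metric c H dense dist])
    moreover have "strongly_measurable M F d H"
      by (rule strongly_measurableI[where c = c, OF metric c H dense dist])
    ultimately show ?thesis
      by (intro exI[of _ H]) (auto simp: H_def)
  qed
  then obtain H where H: "H \<in> M \<rightarrow>\<^sub>M metric_borel F d" "strongly_measurable M F d H"
    and eq: "\<And>x. x \<in> space M - N \<Longrightarrow> fibre_map G x = H x"
    by blast
  have AE: "AE x in M. fibre_map G x = H x"
    using N eq by (intro AE_I'[of N]) auto
  moreover have "strongly_measurable M F d (fibre_map G)"
    by (rule strongly_measurable_cong_AE[OF H(2) AE G])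
  moreover have "fibre_map G \<in> M \<rightarrow>\<^sub>M metric_borel F d" if "complete_measure M"
    using complete_measure.measurable_cong_off_null_set[OF that H(1) N eq] G metric by simp
  ultimately show ?thesis
    using H by blast
qed

end
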